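(* Let $\{(U_k,\bar y_k,y_k,S_k,\mu_k,\alpha_k)\}_{k\ge 1}$ be a sequence generated by the Relaxed Interior Point algorithm described in the context, applied to the semidefinite program $\min\{C\bullet X : A_i\bullet X=b_i,\ i=1,\dots,m,\ X\succeq 0\}$ with rank parameter $r$. Assume that there exists $\bar k>0$ such that $\alpha_k=1$ for all $k\ge\bar k$. Assume that this semidefinite program has a solution of rank $r$ and that the sequence $\{(U_k,y_k)\}$ admits a limit point $(U^\dagger,y^\dagger)\in\mathbb{R}^{n\times r}\times\mathbb{R}^m$. Set $X^\dagger=U^\dagger(U^\dagger)^T$ and $S^\dagger=C-\mathcal{A}^Ty^\dagger$. Then: (i) $X^\dagger$ is primal feasible, i.e. $X^\dagger\succeq 0$ and $A_i\bullet X^\dagger=b_i$ for $i=1,\dots,m$; (ii) $X^\dagger S^\dagger=0$; (iii) $S^\dagger$ is positive semidefinite.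
   Context: Let $C,A_1,\dots,A_m$ be real symmetric $n\times n$ matrices, with $A_1,\dots,A_m$ linearly independent, and let $b\in\mathbb{R}^m$. For matrices write $U\bullet V=\mathrm{trace}(U^TV)$, and let $\|\cdot\|_F$ be the associated Frobenius norm; vector norms are Euclidean. Define $\mathcal{A}(X)=(A_i\bullet X)_{i=1}^m\in\mathbb{R}^m$ and $\mathcal{A}^Tv=\sum_{i=1}^m v_iA_i$. "Positive definite" refers to symmetric matrices. Standing assumption: there is a triple $(X^*,y^*,S^* )$ with $X^*=U^*(U^* )^T$, $U^*\in\mathbb{R}^{n\times r}$, satisfying $\mathcal{A}(X^* )=b$, $S^*=C-\mathcal{A}^Ty^*\succeq0$, $X^*S^*=0$. Set $\omega^*=\frac12\|\mathcal{A}(I_n)\|^2+\frac12\|S^*-I_n\|_F^2$. Relaxed Interior Point algorithm. Input: an integer $r>0$, $U_0\in\mathbb{R}^{n\times r}$, $y_0\in\mathbb{R}^m$ such that $S_0=C-\mathcal{A}^Ty_0$ is positive definite, $\mu_0>0$, $\gamma\ge\sqrt{\omega^*}$, $\sigma\in(0,1)$. The barrier parameters satisfy $\mu_k=\sigma\mu_{k-1}$. For $k=1,2,\dots$: 1. A pair $(U_k,\bar y_k)\in\mathbb{R}^{n\times r}\times\mathbb{R}^m$ is found such that $$\|\mathcal{A}(U_kU_k^T+\mu_kI_n)-b\|^2+\|(U_kU_k^T+\mu_kI_n)(C-\mathcal{A}^T\bar y_k)-\mu_kI_n\|_F^2\le\gamma^2\mu_k^2 .$$ 2. Put $\Delta y=\bar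 y_k-y_{k-1}$ and $\Delta S=-\mathcal{A}^T\Delta y$. If $C-\mathcal{A}^T\bar y_k$ is positive definite, set $\alpha_k=1$; otherwise choose $\alpha_k\in(0,1]$ (by backtracking) such that $S_{k-1}+\alpha_k\Delta S$ is positive definite. 3. Set $y_k=y_{k-1}+\alpha_k\Delta y$ and $S_k=S_{k-1}+\alpha_k\Delta S=C-\mathcal{A}^Ty_k$, which is positive definite. *)

theory Defs
  imports "HOL-Analysis.Analysis"
begin

text \<open>
  An \<open>n \<times> r\<close> matrix has type \<open>real^'r^'n\<close>. A family \<open>A\<^sub>1, \<dots>, A\<^sub>m\<close> of
  \<open>n \<times> n\<close> matrices is a function \<open>A :: 'm \<Rightarrow> real^'n^'n\<close>.
\<close>

definition symmetric_mat :: "real^'n^'n \<Rightarrow> bool" where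
  "symmetric_mat M \<longleftrightarrow> transpose M = M"

definition pos_semidef :: "real^'n^'n \<Rightarrow> bool" where
  "pos_semidef M \<longleftrightarrow> symmetric_mat M \<and> (\<forall>x. 0 \<le> x \<bullet> (M *v x))"

definition pos_def :: "real^'n^'n \<Rightarrow> bool" where
  "pos_def M \<longleftrightarrow> symmetric_mat M \<and> (\<forall>x. x \<noteq> 0 \<longrightarrow> 0 < x \<bullet> (M *v x))"

definition frob_inner :: "real^'n^'k \<Rightarrow> real^'n^'k \<Rightarrow> real" where
  "frob_inner U V = trace (transpose U ** V)"

definition frob_norm :: "real^'n^'k \<Rightarrow> real" where
  "frob_norm U = sqrt (frob_inner U U)"

definition constr_map :: "('m::finite \<Rightarrow> real^'n^'n) \<Rightarrow> real^'n^'n \<Rightarrow> real^'m" where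
  "constr_map A X = (\<chi> i. frob_inner (A i) X)"

definition constr_adj :: "('m::finite \<Rightarrow> real^'n^'n) \<Rightarrow> real^'m \<Rightarrow> real^'n^'n" where
  "constr_adj A v = (\<Sum>i\<in>UNIV. (v $ i) *\<^sub>R A i)"

text \<open>
  Linear independence of the indexed family: \<open>independent\<close> is a property of the set of
  members, so injectivity is needed to rule out repetitions.
\<close>
definition lin_indep_family :: "('m \<Rightarrow> real^'n^'n) \<Rightarrow> bool" where
  "lin_indep_family A \<longleftrightarrow> inj A \<and> independent (range A)"

definition sdp_feasible :: "('m::finite \<Rightarrow> real^'n^'n) \<Rightarrow> real^'m \<Rightarrow> real^'n^'n \<Rightarrow> bool" where
  "sdp_feasible A b X \<longleftrightarrow> pos_semidef X \<and> (\<forall>i. frob_inner (A i) X = b $ i)"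

definition sdp_solution ::
  "real^'n^'n \<Rightarrow> ('m::finite \<Rightarrow> real^'n^'n) \<Rightarrow> real^'m \<Rightarrow> real^'n^'n \<Rightarrow> bool" where
  "sdp_solution C A b X \<longleftrightarrow>
     sdp_feasible A b X \<and> (\<forall>Y. sdp_feasible A b Y \<longrightarrow> frob_inner C X \<le> frob_inner C Y)"

definition omega_star :: "('m::finite \<Rightarrow> real^'n^'n) \<Rightarrow> real^'n^'n \<Rightarrow> real" where
  "omega_star A S =
     1/2 * (norm (constr_map A (mat 1)))\<^sup>2 + 1/2 * (frob_norm (S - mat 1))\<^sup>2"

text \<open>
  Step 1 for the pair \<open>(U, z)\<close>, where \<open>z\<close> stands for the trial multiplier (the paper's y-bar).
\<close>
definition inexact_kkt ::
  "real^'n^'n \<Rightarrow> ('m::finite \<Rightarrow> real^'n^'n) \<Rightarrow> real^'m \<Rightarrow> real \<Rightarrow> real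
     \<Rightarrow> real^'r^'n \<Rightarrow> real^'m \<Rightarrow> bool" where
  "inexact_kkt C A b \<gamma> \<mu> U z \<longleftrightarrow>
     (norm (constr_map A (U ** transpose U + \<mu> *\<^sub>R mat 1) - b))\<^sup>2
     + (frob_norm ((U ** transpose U + \<mu> *\<^sub>R mat 1) ** (C - constr_adj A z) - \<mu> *\<^sub>R mat 1))\<^sup>2
       \<le> \<gamma>\<^sup>2 * \<mu>\<^sup>2"

text \<open>
  \<open>rip_sequence\<close>: the sequences form a run of the Relaxed Interior Point algorithm.
  The entries at index 0 of \<open>U\<close>, \<open>y\<close>, \<open>S\<close>, \<open>\<mu>\<close> are the input data; those of \<open>ybar\<close> and \<open>\<alpha>\<close>
  are unconstrained dummies. The identity \<open>S k = C - constr_adj A (y k)\<close> and positive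
  definiteness of \<open>S k\<close> for \<open>k \<ge> 1\<close> are consequences of the update rules and hence not
  imposed. No particular backtracking factor is prescribed for \<open>\<alpha> k\<close>.
\<close>
definition rip_sequence ::
  "real^'n^'n \<Rightarrow> ('m::finite \<Rightarrow> real^'n^'n) \<Rightarrow> real^'m \<Rightarrow> real \<Rightarrow> real
     \<Rightarrow> (nat \<Rightarrow> real^'r^'n) \<Rightarrow> (nat \<Rightarrow> real^'m) \<Rightarrow> (nat \<Rightarrow> real^'m) \<Rightarrow> (nat \<Rightarrow> real^'n^'n)
     \<Rightarrow> (nat \<Rightarrow> real) \<Rightarrow> (nat \<Rightarrow> real) \<Rightarrow> bool" where
  "rip_sequence C A b \<gamma> \<sigma> U ybar y S \<mu> \<alpha> \<longleftrightarrow>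
     S 0 = C - constr_adj A (y 0) \<and> pos_def (S 0) \<and> 0 < \<mu> 0 \<and>
     (\<forall>k\<ge>1.
        \<mu> k = \<sigma> * \<mu> (k - 1) \<and>
        inexact_kkt C A b \<gamma> (\<mu> k) (U k) (ybar k) \<and>
        (let \<Delta>y = ybar k - y (k - 1); \<Delta>S = - constr_adj A \<Delta>y in
           (if pos_def (C - constr_adj A (ybar k)) then \<alpha> k = 1
            else 0 < \<alpha> k \<and> \<alpha> k \<le> 1 \<and> pos_def (S (k - 1) + \<alpha> k *\<^sub>R \<Delta>S)) \<and>
           y k = y (k - 1) + \<alpha> k *\<^sub>R \<Delta>y \<and>
           S k = S (k - 1) + \<alpha> k *\<^sub>R \<Delta>S))"

definition is_limit_point :: "(nat \<Rightarrow> 'a::topological_space) \<Rightarrow> 'a \<Rightarrow> bool" where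
  "is_limit_point f l \<longleftrightarrow> (\<exists>\<phi>. strict_mono (\<phi> :: nat \<Rightarrow> nat) \<and> (f \<circ> \<phi>) \<longlonglongrightarrow> l)"

end

theory Submission
  imports Defs
begin

text \<open>
  From index \<open>kbar\<close> on, full steps are taken, so \<open>y k = ybar k\<close> and the inexact optimality
  condition holds at \<open>(U k, y k)\<close>. As \<open>\<mu> k \<longlonglongrightarrow> 0\<close>, passing to the limit along the
  subsequence makes both residuals vanish at the limit point, while \<open>Sdag\<close> is a limit of
  positive definite matrices.
\<close>

text \<open>Both are the same double sum of entrywise products, in opposite order. This
  identification, with the one for \<open>frob_norm\<close>, makes the library's limit rules for
  \<open>inner\<close> and \<open>norm\<close> applicable.\<close>

lemma frob_inner_eq_inner: "frob_inner U V = U \<bullet> V"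
  unfolding frob_inner_def trace_def matrix_matrix_mult_def transpose_def inner_vec_def
  by simp (rule sum.swap)

lemma frob_norm_eq_norm: "frob_norm U = norm U"
  by (simp add: frob_norm_def frob_inner_eq_inner norm_eq_sqrt_inner)

text \<open>In finite dimension every bilinear map is bounded; this is used for continuity of the
  matrix product.\<close>

lemma bounded_bilinear_matrix_mult:
  "bounded_bilinear ((**) :: real^'n^'k \<Rightarrow> real^'p^'n \<Rightarrow> real^'p^'k)"
  unfolding bilinear_conv_bounded_bilinear[symmetric] bilinear_def
  by (auto intro!: linearI simp: matrix_matrix_mult_def vec_eq_iff
      sum.distrib sum_distrib_left algebra_simps)

lemmas tendsto_matrix_mult [tendsto_intros] =
  bounded_bilinear.tendsto[OF bounded_bilinear_matrix_mult]

lemma tendsto_transpose [tendsto_intros]: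
  fixes f :: "'a \<Rightarrow> real^'n^'k"
  assumes "(f \<longlongrightarrow> L) F"
  shows "((\<lambda>x. transpose (f x)) \<longlongrightarrow> transpose L) F"
  unfolding transpose_def by (intro tendsto_vec_lambda tendsto_vec_nth assms)

lemma tendsto_constr_map [tendsto_intros]:
  assumes "(f \<longlongrightarrow> L) F"
  shows "((\<lambda>x. constr_map A (f x)) \<longlongrightarrow> constr_map A L) F"
  unfolding constr_map_def frob_inner_eq_inner
  by (intro tendsto_vec_lambda tendsto_inner tendsto_const assms)

lemma tendsto_constr_adj [tendsto_intros]:
  assumes "(f \<longlongrightarrow> L) F"
  shows "((\<lambda>x. constr_adj A (f x)) \<longlongrightarrow> constr_adj A L) F"
  unfolding constr_adj_def by (intro tendsto_intros assms)

lemma constr_adj_add: "constr_adj A (u + v) = constr_adj A u + constr_adj A v"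
  by (simp add: constr_adj_def scaleR_left_distrib sum.distrib)

lemma constr_adj_scaleR: "constr_adj A (c *\<^sub>R v) = c *\<^sub>R constr_adj A v"
  by (simp add: constr_adj_def scaleR_sum_right)

text \<open>The quadratic form at \<open>x\<close> is the squared length of
  \<open>transpose U *v x\<close>.\<close>

lemma pos_semidef_mult_transpose: "pos_semidef (U ** transpose U)"
proof -
  have "x \<bullet> ((U ** transpose U) *v x) = (transpose U *v x) \<bullet> (transpose U *v x)" for x
    by (simp add: transpose_matrix_vector flip: matrix_vector_mul_assoc dot_lmul_matrix)
  then show ?thesis
    by (simp add: pos_semidef_def symmetric_mat_def matrix_transpose_mul)
qed

lemma pos_def_imp_pos_semidef: "pos_def M \<Longrightarrow> pos_semidef M"
  unfolding pos_def_def pos_semidef_def by (metis inner_zero_left order.refl less_imp_le)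

text \<open>Symmetry and each inequality \<open>0 \<le> v \<bullet> (M *v v)\<close>, for fixed
  \<open>v\<close>, are closed conditions on \<open>M\<close>. Symmetry passes to \<open>L\<close>
  by uniqueness of limits, since \<open>f\<close> and its transpose eventually agree.\<close>

lemma pos_semidef_limit:
  assumes "(f \<longlongrightarrow> L) F" and "F \<noteq> bot" and "\<forall>\<^sub>F x in F. pos_semidef (f x)"
  shows "pos_semidef L"
proof -
  have "((\<lambda>x. transpose (f x)) \<longlongrightarrow> transpose L) F"
    by (intro tendsto_intros assms)
  moreover have "\<forall>\<^sub>F x in F. transpose (f x) = f x"
    using assms(3) by eventually_elim (simp add: pos_semidef_def symmetric_mat_def)
  ultimately have "(f \<longlongrightarrow> transpose L) F"
    by (simp add: tendsto_cong)
  with assms(1,2) have "transpose L = L"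
    by (metis tendsto_unique)
  moreover have "0 \<le> v \<bullet> (L *v v)" for v
  proof (rule tendsto_lowerbound[OF _ _ assms(2)])
    show "((\<lambda>x. v \<bullet> (f x *v v)) \<longlongrightarrow> v \<bullet> (L *v v)) F"
      unfolding matrix_vector_mult_def
      by (intro tendsto_intros tendsto_vec_lambda assms(1))
    show "\<forall>\<^sub>F x in F. 0 \<le> v \<bullet> (f x *v v)"
      using assms(3) by eventually_elim (simp add: pos_semidef_def)
  qed
  ultimately show ?thesis
    by (simp add: pos_semidef_def symmetric_mat_def)
qed

context
  fixes C :: "real^'n^'n" and A :: "'m::finite \<Rightarrow> real^'n^'n" and b :: "real^'m"
    and \<gamma> \<sigma> :: real and U :: "nat \<Rightarrow> real^'r^'n" and ybar y :: "nat \<Rightarrow> real^'m"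
    and S :: "nat \<Rightarrow> real^'n^'n" and \<mu> \<alpha> :: "nat \<Rightarrow> real"
  assumes rip: "rip_sequence C A b \<gamma> \<sigma> U ybar y S \<mu> \<alpha>"
begin

text \<open>By linearity of \<open>constr_adj A\<close>, the coupled updates of \<open>y\<close> and
  \<open>S\<close> preserve this relation for any step length.\<close>

lemma rip_S_eq: "S k = C - constr_adj A (y k)"
proof (induction k)
  case 0
  show ?case using rip by (simp add: rip_sequence_def)
next
  case (Suc k)
  have "y (Suc k) = y k + \<alpha> (Suc k) *\<^sub>R (ybar (Suc k) - y k)"
    and "S (Suc k) = S k + \<alpha> (Suc k) *\<^sub>R (- constr_adj A (ybar (Suc k) - y k))"
    using rip by (auto simp: rip_sequence_def Let_def dest!: spec[of _ "Suc k"])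
  with Suc show ?case
    by (simp add: constr_adj_add constr_adj_scaleR)
qed

text \<open>Transfers the inexact condition, imposed on the trial multiplier \<open>ybar k\<close>,
  to the iterate \<open>y k\<close>.\<close>

lemma rip_full_step: "k \<ge> 1 \<Longrightarrow> \<alpha> k = 1 \<Longrightarrow> y k = ybar k"
  using rip by (simp add: rip_sequence_def Let_def)

text \<open>Either the trial slack is positive definite and the full step makes it
  \<open>S k\<close>, or the choice of \<alpha> guarantees positive definiteness.\<close>

lemma rip_S_pos_def: "pos_def (S k)"
proof (cases "k = 0")
  case True
  then show ?thesis using rip unfolding rip_sequence_def by blast
next
  case False
  then have k: "k \<ge> 1" by simp
  show ?thesis
  proof (cases "pos_def (C - constr_adj A (ybar k))")
    case True
    with rip k have "\<alpha> k = 1" by (auto simp: rip_sequence_def Let_def)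
    with True show ?thesis by (simp add: rip_S_eq rip_full_step[OF k])
  next
    case False
    with rip k show ?thesis unfolding rip_sequence_def Let_def by metis
  qed
qed

lemma rip_mu_eq: "\<mu> k = \<mu> 0 * \<sigma> ^ k"
proof (induction k)
  case (Suc k)
  moreover have "\<mu> (Suc k) = \<sigma> * \<mu> k"
    using rip by (auto simp: rip_sequence_def dest!: spec[of _ "Suc k"])
  ultimately show ?case by simp
qed simp

end

theorem proposition2p2:
  fixes C :: "real^'n^'n"
    and A :: "'m::finite \<Rightarrow> real^'n^'n"
    and b :: "real^'m"
    and Xstar Sstar :: "real^'n^'n" and Ustar :: "real^'r^'n" and ystar :: "real^'m"
    and \<gamma> \<sigma> :: real
    and U :: "nat \<Rightarrow> real^'r^'n" and ybar y :: "nat \<Rightarrow> real^'m"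
    and S :: "nat \<Rightarrow> real^'n^'n" and \<mu> \<alpha> :: "nat \<Rightarrow> real"
    and kbar :: nat
    and Udag :: "real^'r^'n" and ydag :: "real^'m" and Xdag Sdag :: "real^'n^'n"
  assumes "symmetric_mat C" and "\<And>i. symmetric_mat (A i)" and "lin_indep_family A"
    and "Xstar = Ustar ** transpose Ustar" and "constr_map A Xstar = b"
    and "Sstar = C - constr_adj A ystar" and "pos_semidef Sstar" and "Xstar ** Sstar = 0"
    and "\<gamma> \<ge> sqrt (omega_star A Sstar)" and "0 < \<sigma>" and "\<sigma> < 1"
    and "rip_sequence C A b \<gamma> \<sigma> U ybar y S \<mu> \<alpha>"
    and "kbar > 0" and "\<And>k. k \<ge> kbar \<Longrightarrow> \<alpha> k = 1"
    and "\<exists>X. sdp_solution C A b X \<and> rank X = CARD('r)"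
    and "is_limit_point (\<lambda>k. (U k, y k)) (Udag, ydag)"
    and "Xdag = Udag ** transpose Udag" and "Sdag = C - constr_adj A ydag"
  shows "(pos_semidef Xdag \<and> (\<forall>i. frob_inner (A i) Xdag = b $ i))
         \<and> Xdag ** Sdag = 0
         \<and> pos_semidef Sdag"
proof -
  note rip = assms(12)
  obtain \<phi> where \<phi>: "strict_mono \<phi>"
    and lim: "((\<lambda>k. (U k, y k)) \<circ> \<phi>) \<longlonglongrightarrow> (Udag, ydag)"
    using assms(16) unfolding is_limit_point_def by blast
  have U_lim: "(\<lambda>i. U (\<phi> i)) \<longlonglongrightarrow> Udag" and y_lim: "(\<lambda>i. y (\<phi> i)) \<longlonglongrightarrow> ydag"
    using tendsto_fst[OF lim] tendsto_snd[OF lim] by (simp_all add: o_def)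
  have "(\<lambda>k. \<mu> 0 * \<sigma> ^ k) \<longlonglongrightarrow> \<mu> 0 * 0"
    by (intro tendsto_intros LIMSEQ_realpow_zero) (use assms(10,11) in auto)
  from LIMSEQ_subseq_LIMSEQ[OF this \<phi>] have \<mu>_lim: "(\<lambda>i. \<mu> (\<phi> i)) \<longlonglongrightarrow> 0"
    by (simp add: o_def flip: rip_mu_eq[OF rip])

  \<comment> \<open>The step 1 residual as a jointly continuous function of the barrier parameter
    and the iterates, so that it can be evaluated at \<mu> = 0.\<close>
  let ?res = "\<lambda>\<mu> U y.
    (norm (constr_map A (U ** transpose U + \<mu> *\<^sub>R mat 1) - b))\<^sup>2
    + (norm ((U ** transpose U + \<mu> *\<^sub>R mat 1) ** (C - constr_adj A y) - \<mu> *\<^sub>R mat 1))\<^sup>2"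
  have bound: "?res (\<mu> (\<phi> i)) (U (\<phi> i)) (y (\<phi> i)) \<le> \<gamma>\<^sup>2 * (\<mu> (\<phi> i))\<^sup>2" if "i \<ge> kbar" for i
  proof -
    \<comment> \<open>A strictly increasing index map satisfies \<open>i \<le> \<phi> i\<close>; the
      second bound comes from \<open>kbar > 0\<close> and excludes the dummy entry
      \<open>ybar 0\<close>.\<close>
    have ge: "\<phi> i \<ge> kbar" "\<phi> i \<ge> 1"
      using seq_suble[OF \<phi>, of i] that assms(13) by linarith+
    then have "inexact_kkt C A b \<gamma> (\<mu> (\<phi> i)) (U (\<phi> i)) (ybar (\<phi> i))"
      using rip unfolding rip_sequence_def by blast
    then show ?thesis
      by (simp add: inexact_kkt_def frob_norm_eq_norm rip_full_step[OF rip ge(2) assms(14)[OF ge(1)]])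
  qed
  have "?res 0 Udag ydag \<le> \<gamma>\<^sup>2 * 0\<^sup>2"
  proof (rule LIMSEQ_le)
    show "(\<lambda>i. ?res (\<mu> (\<phi> i)) (U (\<phi> i)) (y (\<phi> i))) \<longlonglongrightarrow> ?res 0 Udag ydag"
      by (intro tendsto_intros U_lim y_lim \<mu>_lim)
    show "(\<lambda>i. \<gamma>\<^sup>2 * (\<mu> (\<phi> i))\<^sup>2) \<longlonglongrightarrow> \<gamma>\<^sup>2 * 0\<^sup>2"
      by (intro tendsto_intros \<mu>_lim)
  qed (use bound in blast)
  \<comment> \<open>At \<mu> = 0 the identity terms vanish, and a sum of two squares bounded by zero
    forces both norms to be zero.\<close>
  then have "constr_map A Xdag = b" and compl: "Xdag ** Sdag = 0"
    using assms(17,18) by (simp_all add: sum_power2_le_zero_iff)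
  then have "\<forall>i. frob_inner (A i) Xdag = b $ i"
    by (auto simp: constr_map_def)
  moreover have "pos_semidef Sdag"
  \<comment> \<open>The slacks \<open>S (\<phi> i)\<close> are positive definite and converge to
    \<open>Sdag\<close>; only semidefiniteness survives the limit.\<close>
  proof (rule pos_semidef_limit)
    show "(\<lambda>i. C - constr_adj A (y (\<phi> i))) \<longlonglongrightarrow> Sdag"
      unfolding assms(18) by (intro tendsto_intros y_lim)
    show "\<forall>\<^sub>F i in sequentially. pos_semidef (C - constr_adj A (y (\<phi> i)))"
      using rip_S_pos_def[OF rip] by (simp add: rip_S_eq[OF rip] pos_def_imp_pos_semidef)
  qed simp
  ultimately show ?thesis
    using compl pos_semidef_mult_transpose by (simp add: assms(17))
qed

end
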